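(* There is a constant $C>0$ such that the following holds. Let $G$ be any finite graph with $n\ge 2$ vertices and maximum degree $\Delta$, let $q\ge\Delta+2$, and consider the self-organizing network coloring game on $G$ with $q$ colors in which all players use the greedy and selfish strategy, started from an arbitrary initial coloring. Let $T$ be the number of rounds until all players have payoff $1$ (the conflict resolving time). Then $\mathbb{E}[T]\le C\log n$; that is, the game is expected to converge in $O(\log n)$ rounds.
   Context: Network coloring game: players are the vertices $1,\dots,n$ of $G$; $N(i)$ denotes the neighbours of $i$. There are $q$ colors. In discrete rounds $t=0,1,2,\dots$ each player $i$ holds a color $l_i(t)$ and has payoff $U_i(t)=1$ if $l_i(t)\ne l_j(t)$ for all $j\in N(i)$ and $U_i(t)=0$ otherwise. Greedy and selfish strategy: a player with payoff $1$ keeps its color; a player with payoff $0$ chooses its next color uniformly at random among the colors not used by any of its neighbours in the previous round, independently of the other players. The game has converged once all payoffs equal $1$. *)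

theory Defs
  imports "HOL-Probability.Probability"
begin

definition simple_graph :: "nat \<Rightarrow> nat set set \<Rightarrow> bool" where
  "simple_graph n E \<longleftrightarrow> (\<forall>e\<in>E. e \<subseteq> {1..n} \<and> card e = 2)"

definition neighbours :: "nat set set \<Rightarrow> nat \<Rightarrow> nat set" where
  "neighbours E i = {j. {i, j} \<in> E}"

definition max_degree :: "nat \<Rightarrow> nat set set \<Rightarrow> nat" where
  "max_degree n E = Max ((\<lambda>i. card (neighbours E i)) ` {1..n})"

text \<open>
  A coloring with \<open>q\<close> colors is a function in \<open>{1..n} \<rightarrow>\<^sub>E {1..q}\<close>; it takes the value
  \<open>undefined\<close> outside of the vertex set.
\<close>

type_synonym coloring = "nat \<Rightarrow> nat"

definition payoff :: "nat set set \<Rightarrow> coloring \<Rightarrow> nat \<Rightarrow> nat" where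
  "payoff E l i = (if \<forall>j\<in>neighbours E i. l i \<noteq> l j then 1 else 0)"

definition next_color :: "nat set set \<Rightarrow> nat \<Rightarrow> coloring \<Rightarrow> nat \<Rightarrow> nat pmf" where
  "next_color E q l i =
     (if payoff E l i = 1 then return_pmf (l i)
      else pmf_of_set ({1..q} - l ` neighbours E i))"

text \<open>The product distribution expresses that the players choose independently of each other.\<close>

definition next_coloring :: "nat \<Rightarrow> nat set set \<Rightarrow> nat \<Rightarrow> coloring \<Rightarrow> coloring pmf" where
  "next_coloring n E q l = Pi_pmf {1..n} undefined (next_color E q l)"

text \<open>
  The law of the round-\<open>t\<close> coloring given the colorings \<open>\<omega> 0, \<dots>, \<omega> (t - 1)\<close> of the earlier
  rounds; \<open>l0\<close> is the initial coloring.
\<close>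

definition round_law ::
  "nat \<Rightarrow> nat set set \<Rightarrow> nat \<Rightarrow> coloring \<Rightarrow> nat \<Rightarrow> (nat \<Rightarrow> coloring) \<Rightarrow> coloring measure" where
  "round_law n E q l0 t \<omega> =
     measure_pmf (case t of 0 \<Rightarrow> return_pmf l0 | Suc s \<Rightarrow> next_coloring n E q (\<omega> s))"

interpretation game: Ionescu_Tulcea "round_law n E q l0" "\<lambda>_. count_space UNIV" for n E q l0
proof (rule Ionescu_Tulcea.intro)
  fix t :: nat
  show "round_law n E q l0 t \<in>
      measurable (PiM {0..<t} (\<lambda>_. count_space UNIV)) (subprob_algebra (count_space UNIV))"
  proof (cases t)
    case 0
    then show ?thesis
      by (simp add: round_law_def[abs_def] space_subprob_algebra
          measure_pmf.subprob_space_axioms)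
  next
    case (Suc s)
    have "(\<lambda>\<omega>. \<omega> s) \<in> measurable (PiM {0..<t} (\<lambda>_. count_space UNIV))
        (count_space (UNIV :: coloring set))"
      using Suc by (intro measurable_component_singleton) auto
    moreover have "(\<lambda>l. measure_pmf (next_coloring n E q l)) \<in>
        measurable (count_space UNIV) (subprob_algebra (count_space UNIV))"
      by (simp add: space_subprob_algebra measure_pmf.subprob_space_axioms)
    ultimately show ?thesis
      unfolding Suc round_law_def[abs_def] nat.case by (rule measurable_compose)
  qed
next
  fix t :: nat and \<omega> :: "nat \<Rightarrow> coloring"
  show "prob_space (round_law n E q l0 t \<omega>)"
    by (simp add: round_law_def measure_pmf.prob_space_axioms)
qed

text \<open>
  The law of the whole play, as a measure on sequences of colorings: \<open>\<omega> t i\<close> is the color of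
  player \<open>i\<close> in round \<open>t\<close>. It is the measure with the one-round laws \<open>round_law\<close> that the
  Ionescu-Tulcea theorem provides; \<open>emeasure_game_law_cylinder\<close> below gives its values on
  cylinder sets.
\<close>

definition game_law ::
  "nat \<Rightarrow> nat set set \<Rightarrow> nat \<Rightarrow> coloring \<Rightarrow> (nat \<Rightarrow> coloring) measure" where
  "game_law n E q l0 = game.PF.lim n E q l0"

lemma sets_game_law: "sets (game_law n E q l0) = sets (PiM UNIV (\<lambda>_. count_space UNIV))"
  by (simp add: game_law_def)

lemma space_game_law: "space (game_law n E q l0) = UNIV"
  using sets_eq_imp_space_eq[OF sets_game_law] by (simp add: space_PiM)

lemma emeasure_game_law_cylinder:
  "emeasure (game_law n E q l0) {\<omega>. \<forall>s\<le>t. \<omega> s = h s} =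
     indicator {l0} (h 0) * (\<Prod>s<t. ennreal (pmf (next_coloring n E q (h s)) (h (Suc s))))"
proof -
  let ?M = "\<lambda>_::nat. count_space (UNIV :: coloring set)"
  let ?C = "\<lambda>m. game.C n E q l0 0 m (\<lambda>_. undefined)"
  define A where "A m = PiE {0..<m} (\<lambda>s. {h s})" for m
  have A[measurable]: "A m \<in> sets (PiM {0..<m} ?M)" for m
    unfolding A_def by (intro sets_PiM_I_finite) auto
  have C_A: "emeasure (?C m) (A m) = (\<Prod>s<m. emeasure (round_law n E q l0 s h) {h s})" for m
  proof (induction m)
    case 0
    show ?case using A[of 0] by (simp add: A_def emeasure_return)
  next
    case (Suc m)
    have und: "(\<lambda>_. undefined) \<in> space (PiM {0..<0} ?M)"
      by (simp add: space_PiM)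
    have step: "emeasure (game.eP n E q l0 m \<omega>) (A (Suc m)) =
        emeasure (round_law n E q l0 m h) {h m} * indicator (A m) \<omega>"
      if \<omega>: "\<omega> \<in> space (PiM {0..<m} ?M)" for \<omega>
    proof -
      have upd: "fun_upd \<omega> m x \<in> A (Suc m) \<longleftrightarrow> \<omega> \<in> A m \<and> x = h m" for x
        using \<omega> by (auto simp: A_def PiE_iff space_PiM extensional_def less_Suc_eq Ball_def)
      show ?thesis
      proof (cases "\<omega> \<in> A m")
        case True
        have "round_law n E q l0 m \<omega> = round_law n E q l0 m h"
          using True by (auto simp: round_law_def A_def PiE_iff split: nat.split)
        moreover have "fun_upd \<omega> m -` A (Suc m) = {h m}"
          using True by (auto simp: upd)
        ultimately show ?thesis
          using True by (simp add: game.emeasure_eP[OF \<omega> A])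
      next
        case False
        then have "fun_upd \<omega> m -` A (Suc m) = {}"
          by (auto simp: upd)
        then show ?thesis
          using False by (simp add: game.emeasure_eP[OF \<omega> A])
      qed
    qed
    have "emeasure (?C (Suc m)) (A (Suc m)) =
        (\<integral>\<^sup>+\<omega>. emeasure (game.eP n E q l0 m \<omega>) (A (Suc m)) \<partial>?C m)"
      unfolding game.C.simps add_0
      using game.measurable_eP[of n E q l0 m]
      by (intro emeasure_bind[where N = "PiM {0..<Suc m} ?M"])
         (auto simp: game.space_C[OF und] space_PiM
           measurable_cong_sets[OF game.sets_C[OF und] refl])
    also have "\<dots> = (\<integral>\<^sup>+\<omega>. emeasure (round_law n E q l0 m h) {h m} * indicator (A m) \<omega> \<partial>?C m)"
      by (intro nn_integral_cong step) (use game.space_C[OF und, of n E q l0 m] in simp)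
    also have "\<dots> = emeasure (round_law n E q l0 m h) {h m} * emeasure (?C m) (A m)"
      by (rule nn_integral_cmult_indicator) (use game.sets_C[OF und, of n E q l0 m] A[of m] in simp)
    finally show ?case
      using Suc by (simp add: mult.commute)
  qed
  have "{\<omega>. \<forall>s\<le>t. \<omega> s = h s} = prod_emb UNIV ?M {0..<Suc t} (A (Suc t))"
    by (auto simp: prod_emb_def A_def PiE_iff space_PiM less_Suc_eq_le)
  then have "emeasure (game_law n E q l0) {\<omega>. \<forall>s\<le>t. \<omega> s = h s} =
      emeasure (game.CI n E q l0 {0..<Suc t}) (A (Suc t))"
    unfolding game_law_def by (simp only: game.lim[OF finite_atLeastLessThan A])
  also have "\<dots> = emeasure (?C (Suc t)) (A (Suc t))"
    using sets.sets_into_space[OF A[of "Suc t"]]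
    by (subst game.emeasure_CI[OF subset_refl A]) (simp add: prod_emb_id space_PiM)
  also have "\<dots> = (\<Prod>s<Suc t. emeasure (round_law n E q l0 s h) {h s})"
    by (rule C_A)
  also have "\<dots> = emeasure (round_law n E q l0 0 h) {h 0} *
      (\<Prod>s<t. emeasure (round_law n E q l0 (Suc s) h) {h (Suc s)})"
    by (rule prod.lessThan_Suc_shift)
  also have "\<dots> = indicator {l0} (h 0) *
      (\<Prod>s<t. ennreal (pmf (next_coloring n E q (h s)) (h (Suc s))))"
    by (simp add: round_law_def emeasure_pmf_single indicator_def)
  finally show ?thesis .
qed

lemma prob_space_game_law: "prob_space (game_law n E q l0)"
proof
  let ?M = "\<lambda>_::nat. count_space (UNIV :: coloring set)"
  have S: "space (PiM {} ?M) \<in> sets (PiM {} ?M)" by simp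
  have "space (game_law n E q l0) = prod_emb UNIV ?M {} (space (PiM {} ?M))"
    by (auto simp: space_game_law prod_emb_def space_PiM)
  then have "emeasure (game_law n E q l0) (space (game_law n E q l0)) =
      emeasure (game.CI n E q l0 {}) (space (PiM {} ?M))"
    unfolding game_law_def by (simp only: game.lim[OF finite.emptyI S])
  also have "\<dots> = 1"
    using prob_space.emeasure_space_1[OF game.PF.prob_space_P[of "{}" n E q l0]]
    by (simp add: game.CI_def)
  finally show "emeasure (game_law n E q l0) (space (game_law n E q l0)) = 1" .
qed

text \<open>The value is \<open>\<infinity>\<close> on plays that never converge, since the infimum of \<open>{}\<close> is \<open>\<infinity>\<close>.\<close>

definition conflict_resolving_time ::
  "nat \<Rightarrow> nat set set \<Rightarrow> (nat \<Rightarrow> coloring) \<Rightarrow> enat" where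
  "conflict_resolving_time n E \<omega> = Inf {enat t |t. \<forall>i\<in>{1..n}. payoff E (\<omega> t) i = 1}"

end

theory Submission
  imports Defs
begin

text \<open>
  A player with payoff \<open>1\<close> keeps it forever. A player \<open>i\<close> with payoff \<open>0\<close> resolves its conflict
  within two rounds with probability at least a constant \<open>\<delta>\<close>, for the following reason. Let \<open>d\<close> be the
  number of its neighbours in conflict and \<open>m > d\<close> the number of colors not held by its other
  neighbours. Each neighbour in conflict picks a given color with probability at most \<open>1/2\<close>, so
  color \<open>c\<close> is missed by all of them with probability at least \<open>4\<^sup>-\<^sup>w\<close>, where \<open>w = w(c)\<close> is the expected
  number of those picking \<open>c\<close>. The \<open>w(c)\<close> sum to at most \<open>d < m\<close>, hence by convexity at
  least \<open>m/4\<close> colors are expected to be free for \<open>i\<close> after the first round. Once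
  at least \<open>m/8\<close> colors are free, the same estimate, averaged over the pick of \<open>i\<close>,
  shows that the second round resolves the conflict with probability at least \<open>4\<^sup>-\<^sup>8\<close>.
  A union bound over the players then gives \<open>P(T > t) \<le> 2 n r\<^sup>t\<close> with \<open>r = sqrt (1 - \<delta>)\<close>, and summing
  over \<open>t\<close> the minimum of this and \<open>1\<close> yields the logarithmic bound.
\<close>

section \<open>Preliminary integral and convexity estimates\<close>

lemma measure_bind_pmf_eq_integral:
  "measure_pmf.prob (bind_pmf p f) A = measure_pmf.expectation p (\<lambda>x. measure_pmf.prob (f x) A)"
proof -
  have "ennreal (measure_pmf.prob (bind_pmf p f) A) =
      (\<integral>\<^sup>+x. ennreal (measure_pmf.prob (f x) A) \<partial>p)"
    by (simp flip: measure_pmf.emeasure_eq_measure)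
  also have "\<dots> = ennreal (measure_pmf.expectation p (\<lambda>x. measure_pmf.prob (f x) A))"
    by (intro nn_integral_eq_integral measure_pmf.integrable_const_bound[where B = 1]) auto
  finally show ?thesis
    by simp
qed

text \<open>By convexity, 4^-x lies below its chord over [0, 1/2]. The base 4 is chosen so that this
  chord is exactly 1 - x, since 4^(-1/2) = 1/2.\<close>

lemma one_minus_ge_exp_ln4:
  fixes x :: real
  assumes "0 \<le> x" "x \<le> 1/2"
  shows "exp (- (ln 4 * x)) \<le> 1 - x"
proof -
  have "convex_on UNIV (\<lambda>x::real. exp (- (ln 4 * x)))"
    by (rule f''_ge0_imp_convex[where f' = "\<lambda>x. - ln 4 * exp (- (ln 4 * x))"
          and f'' = "\<lambda>x. ln 4 * ln 4 * exp (- (ln 4 * x))"])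
       (auto intro!: derivative_eq_intros simp: algebra_simps)
  from convex_onD[OF this, of "2 * x" 0 "1/2"] assms
  have "exp (- (ln 4 * x)) \<le> (1 - 2 * x) + 2 * x * exp (- (ln 4 / 2))"
    by simp
  also have "exp (- (ln 4 / 2)) = (1/2::real)"
  proof -
    have "ln 4 = 2 * ln (2::real)"
      using ln_realpow[of 2 2] by simp
    then show ?thesis
      by (simp add: exp_minus)
  qed
  finally show ?thesis
    by simp
qed

text \<open>Jensen's inequality for \<open>w \<mapsto> 4\<^sup>-\<^sup>w\<close>, proved by comparison with the tangent line at \<open>w = K\<close>.\<close>

lemma sum_prod_one_minus_ge:
  fixes x :: "'a \<Rightarrow> 'b \<Rightarrow> real" and K :: nat
  assumes "finite S" "finite U"
    and x: "\<And>j c. j \<in> U \<Longrightarrow> c \<in> S \<Longrightarrow> 0 \<le> x j c \<and> x j c \<le> 1/2"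
    and sum_le: "\<And>j. j \<in> U \<Longrightarrow> (\<Sum>c\<in>S. x j c) \<le> 1"
    and card_le: "card U \<le> K * card S"
  shows "real (card S) / 4 ^ K \<le> (\<Sum>c\<in>S. \<Prod>j\<in>U. 1 - x j c)"
proof -
  define w where "w c = (\<Sum>j\<in>U. x j c)" for c
  have exp_K: "exp (- (ln 4 * real K)) = 1 / 4 ^ K"
    by (simp add: exp_minus mult.commute[of "ln 4"] exp_of_nat_mult inverse_eq_divide)
  have "(\<Sum>c\<in>S. w c) = (\<Sum>j\<in>U. \<Sum>c\<in>S. x j c)"
    unfolding w_def by (rule sum.swap)
  also have "\<dots> \<le> (\<Sum>j\<in>U. 1)"
    by (intro sum_mono sum_le)
  also have "\<dots> \<le> real K * real (card S)"
    using card_le by (simp flip: of_nat_mult)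
  finally have w_le: "(\<Sum>c\<in>S. w c) \<le> real K * real (card S)" .
  \<comment> \<open>Since the sum of \<open>w\<close> over \<open>S\<close> is at most
    \<open>K * card S\<close>, the first-order terms of the tangents at \<open>K\<close> add up to
    something nonnegative.\<close>
  have "real (card S) / 4 ^ K \<le>
      1 / 4 ^ K * (real (card S) + ln 4 * (real K * real (card S) - (\<Sum>c\<in>S. w c)))"
    using w_le by (simp add: field_simps)
  also have "\<dots> = (\<Sum>c\<in>S. 1 / 4 ^ K * (1 + ln 4 * (real K - w c)))"
    by (simp add: sum_distrib_left[symmetric] sum.distrib sum_subtractf right_diff_distrib
        algebra_simps flip: sum_divide_distrib sum_distrib_right)
  also have "\<dots> \<le> (\<Sum>c\<in>S. \<Prod>j\<in>U. 1 - x j c)"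
  proof (rule sum_mono)
    fix c assume c: "c \<in> S"
    have "1 / 4 ^ K * (1 + ln 4 * (real K - w c)) \<le> 1 / 4 ^ K * exp (ln 4 * (real K - w c))"
      by (intro mult_left_mono exp_ge_add_one_self) auto
    also have "\<dots> = exp (- (ln 4 * w c))"
      unfolding exp_K[symmetric] exp_add[symmetric] by (simp add: algebra_simps)
    also have "\<dots> = (\<Prod>j\<in>U. exp (- (ln 4 * x j c)))"
      using \<open>finite U\<close> by (simp add: w_def sum_distrib_left sum_negf[symmetric] exp_sum)
    also have "\<dots> \<le> (\<Prod>j\<in>U. 1 - x j c)"
      using x c by (intro prod_mono conjI one_minus_ge_exp_ln4) auto
    finally show "1 / 4 ^ K * (1 + ln 4 * (real K - w c)) \<le> (\<Prod>j\<in>U. 1 - x j c)" .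
  qed
  finally show ?thesis .
qed

section \<open>Laws of single rounds and the expected time as a tail sum\<close>

primrec coloring_after :: "nat \<Rightarrow> nat set set \<Rightarrow> nat \<Rightarrow> coloring \<Rightarrow> nat \<Rightarrow> coloring pmf" where
  "coloring_after n E q l0 0 = return_pmf l0"
| "coloring_after n E q l0 (Suc t) = coloring_after n E q l0 t \<bind> next_coloring n E q"

text \<open>This moves all later estimates from the measure on infinite plays to a Markov chain of
  pmfs. Finite histories grow by appending one round, whose law depends only on the previous
  coloring, so the marginals obey the recursion of \<open>coloring_after\<close>.\<close>

lemma emeasure_game_law_round:
  "emeasure (game_law n E q l0) {\<omega>. \<omega> t \<in> A} = emeasure (coloring_after n E q l0 t) A"
proof -
  let ?M = "\<lambda>_::nat. count_space (UNIV :: coloring set)"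
  let ?C = "\<lambda>m. game.C n E q l0 0 m (\<lambda>_. undefined)"
  define B where "B t A = {\<omega> \<in> space (PiM {0..<Suc t} ?M). \<omega> t \<in> A}" for t A
  have B[measurable]: "B t A \<in> sets (PiM {0..<Suc t} ?M)" for t A
  proof -
    have "(\<lambda>\<omega>. \<omega> t) \<in> measurable (PiM {0..<Suc t} ?M) (count_space UNIV)"
      by (intro measurable_component_singleton) simp
    from measurable_sets[OF this, of A] show ?thesis
      by (simp add: B_def vimage_def Int_def conj_commute)
  qed
  have und: "(\<lambda>_. undefined) \<in> space (PiM {0..<0} ?M)"
    by (simp add: space_PiM)
  have round: "emeasure (?C (Suc m)) (B m A) = (\<integral>\<^sup>+\<omega>. emeasure (round_law n E q l0 m \<omega>) A \<partial>?C m)"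
    for m A
  proof -
    have "emeasure (?C (Suc m)) (B m A) = (\<integral>\<^sup>+\<omega>. emeasure (game.eP n E q l0 m \<omega>) (B m A) \<partial>?C m)"
      unfolding game.C.simps add_0
      using game.measurable_eP[of n E q l0 m]
      by (intro emeasure_bind[where N = "PiM {0..<Suc m} ?M"])
         (auto simp: game.space_C[OF und] space_PiM
           measurable_cong_sets[OF game.sets_C[OF und] refl])
    also have "\<dots> = (\<integral>\<^sup>+\<omega>. emeasure (round_law n E q l0 m \<omega>) A \<partial>?C m)"
    proof (intro nn_integral_cong)
      fix \<omega> assume "\<omega> \<in> space (?C m)"
      then have \<omega>: "\<omega> \<in> space (PiM {0..<m} ?M)"
        by (simp add: game.space_C[OF und])
      have "fun_upd \<omega> m -` B m A = A"
        using \<omega> by (auto simp: B_def space_PiM PiE_iff extensional_def)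
      then show "emeasure (game.eP n E q l0 m \<omega>) (B m A) = emeasure (round_law n E q l0 m \<omega>) A"
        by (simp add: game.emeasure_eP[OF \<omega> B])
    qed
    finally show ?thesis .
  qed
  \<comment> \<open>The induction is on the whole marginal law rather than on single events, because
    the step integrates the law of the next round against it.\<close>
  have marginal: "distr (?C (Suc m)) (count_space UNIV) (\<lambda>\<omega>. \<omega> m) = measure_pmf (coloring_after n E q l0 m)"
    for m
  proof (induction m)
    case 0
    show ?case
    proof (rule measure_eqI)
      fix A
      have "emeasure (distr (?C (Suc 0)) (count_space UNIV) (\<lambda>\<omega>. \<omega> 0)) A = emeasure (?C (Suc 0)) (B 0 A)"
        by (subst emeasure_distr)
           (auto simp: B_def game.space_C[OF und] measurable_cong_sets[OF game.sets_C[OF und] refl]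
             simp del: game.C.simps intro!: arg_cong[where f = "emeasure _"])
      also have "\<dots> = emeasure (coloring_after n E q l0 0) A"
        unfolding round
        using prob_space.emeasure_space_1[OF game.prob_space_C[OF und, of n E q l0 0]]
        by (simp add: round_law_def del: game.C.simps)
      finally show "emeasure (distr (?C (Suc 0)) (count_space UNIV) (\<lambda>\<omega>. \<omega> 0)) A = \<dots>" .
    qed simp
  next
    case (Suc m)
    show ?case
    proof (rule measure_eqI)
      fix A
      have "emeasure (distr (?C (Suc (Suc m))) (count_space UNIV) (\<lambda>\<omega>. \<omega> (Suc m))) A =
          emeasure (?C (Suc (Suc m))) (B (Suc m) A)"
        by (subst emeasure_distr)
           (auto simp: B_def game.space_C[OF und] measurable_cong_sets[OF game.sets_C[OF und] refl]
             simp del: game.C.simps intro!: arg_cong[where f = "emeasure _"])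
      also have "\<dots> = (\<integral>\<^sup>+\<omega>. emeasure (next_coloring n E q (\<omega> m)) A \<partial>?C (Suc m))"
        unfolding round by (simp add: round_law_def)
      also have "\<dots> = (\<integral>\<^sup>+l. emeasure (next_coloring n E q l) A
          \<partial>distr (?C (Suc m)) (count_space UNIV) (\<lambda>\<omega>. \<omega> m))"
        by (subst nn_integral_distr)
           (auto simp: measurable_cong_sets[OF game.sets_C[OF und] refl] simp del: game.C.simps)
      also have "\<dots> = emeasure (coloring_after n E q l0 (Suc m)) A"
        unfolding Suc by simp
      finally show "emeasure (distr (?C (Suc (Suc m))) (count_space UNIV) (\<lambda>\<omega>. \<omega> (Suc m))) A = \<dots>" .
    qed simp
  qed
  \<comment> \<open>The event is decided by rounds 0 to \<open>t\<close>, so the projective limit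
    evaluates it on histories of length \<open>Suc t\<close>.\<close>
  have "{\<omega>. \<omega> t \<in> A} = prod_emb UNIV ?M {0..<Suc t} (B t A)"
    by (auto simp: prod_emb_def B_def PiE_iff space_PiM)
  then have "emeasure (game_law n E q l0) {\<omega>. \<omega> t \<in> A} =
      emeasure (game.CI n E q l0 {0..<Suc t}) (B t A)"
    unfolding game_law_def by (simp only: game.lim[OF finite_atLeastLessThan B])
  also have "\<dots> = emeasure (?C (Suc t)) (B t A)"
    using sets.sets_into_space[OF B[of t A]]
    by (subst game.emeasure_CI[OF subset_refl B]) (simp add: prod_emb_id space_PiM)
  also have "\<dots> = emeasure (distr (?C (Suc t)) (count_space UNIV) (\<lambda>\<omega>. \<omega> t)) A"
    by (subst emeasure_distr)
       (auto simp: B_def game.space_C[OF und] measurable_cong_sets[OF game.sets_C[OF und] refl]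
         simp del: game.C.simps intro!: arg_cong[where f = "emeasure _"])
  finally show ?thesis
    unfolding marginal .
qed

lemma sets_game_law_round: "{\<omega>. \<omega> t \<in> A} \<in> sets (game_law n E q l0)"
proof -
  have "(\<lambda>\<omega>. \<omega> t) \<in> measurable (PiM UNIV (\<lambda>_. count_space UNIV)) (count_space UNIV)"
    by (rule measurable_component_singleton) simp
  from measurable_sets[OF this, of A] show ?thesis
    by (simp add: sets_game_law vimage_def space_PiM)
qed

text \<open>The tail-sum formula for integrals, applied to a constant under a point mass.\<close>

lemma ennreal_of_enat_eq_suminf: "ennreal_of_enat x = (\<Sum>t. indicator {t. enat t < x} t)"
  using nn_integral_enat_function[of "\<lambda>_. x" "return (count_space UNIV) ()"]
  by (simp add: nn_integral_return emeasure_return indicator_def of_bool_def if_distrib cong: if_cong)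

text \<open>If T > t, then round t still has a conflict. The comparison is made pointwise under the
  integral, so only the events of single rounds have to be measurable.\<close>

lemma expected_conflict_resolving_time_le:
  "(\<integral>\<^sup>+\<omega>. ennreal_of_enat (conflict_resolving_time n E \<omega>) \<partial>game_law n E q l0)
     \<le> (\<Sum>t. emeasure (coloring_after n E q l0 t) {l. \<exists>i\<in>{1..n}. payoff E l i \<noteq> 1})"
proof -
  let ?bad = "{l. \<exists>i\<in>{1..n}. payoff E l i \<noteq> 1}"
  have "(\<integral>\<^sup>+\<omega>. ennreal_of_enat (conflict_resolving_time n E \<omega>) \<partial>game_law n E q l0)
      \<le> (\<integral>\<^sup>+\<omega>. (\<Sum>t. indicator {\<omega>. \<omega> t \<in> ?bad} \<omega>) \<partial>game_law n E q l0)"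
  proof (intro nn_integral_mono)
    fix \<omega> :: "nat \<Rightarrow> coloring"
    have "\<omega> t \<in> ?bad" if "enat t < conflict_resolving_time n E \<omega>" for t
    proof (rule ccontr)
      assume "\<omega> t \<notin> ?bad"
      then have "conflict_resolving_time n E \<omega> \<le> enat t"
        unfolding conflict_resolving_time_def by (intro Inf_lower) auto
      with that show False by simp
    qed
    then show "ennreal_of_enat (conflict_resolving_time n E \<omega>) \<le> (\<Sum>t. indicator {\<omega>. \<omega> t \<in> ?bad} \<omega>)"
      unfolding ennreal_of_enat_eq_suminf
      by (intro suminf_le) (auto simp: indicator_def)
  qed
  also have "\<dots> = (\<Sum>t. \<integral>\<^sup>+\<omega>. indicator {\<omega>. \<omega> t \<in> ?bad} \<omega> \<partial>game_law n E q l0)"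
    by (intro nn_integral_suminf borel_measurable_indicator sets_game_law_round)
  also have "\<dots> = (\<Sum>t. emeasure (coloring_after n E q l0 t) ?bad)"
    by (simp only: nn_integral_indicator[OF sets_game_law_round] emeasure_game_law_round)
  finally show ?thesis .
qed

text \<open>The first round leaves an expected fraction of at least 1/4 of the available colors
  free. Its surplus 1/8 over the threshold 1/8 is multiplied by the success probability 4^-8 of the
  second round.\<close>

definition \<delta> :: real where "\<delta> = 1 / (8 * 4 ^ 8)"

section \<open>One round of the game\<close>

locale coloring_game =
  fixes n :: nat and E :: "nat set set" and q :: nat
  assumes graph: "simple_graph n E" and colors: "max_degree n E + 2 \<le> q"
begin

abbreviation conflicted :: "nat \<Rightarrow> coloring set" where
  "conflicted i \<equiv> {l. payoff E l i \<noteq> 1}"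

definition free_colors :: "coloring \<Rightarrow> nat \<Rightarrow> nat set" where
  "free_colors l i = {1..q} - l ` neighbours E i"

lemma finite_free_colors [simp]: "finite (free_colors l i)"
  by (simp add: free_colors_def)

lemma neighbours_subset: "neighbours E i \<subseteq> {1..n}"
  using graph by (fastforce simp: simple_graph_def neighbours_def)

lemma neighbour_vertex: "j \<in> neighbours E i \<Longrightarrow> j \<in> {1..n}"
  using neighbours_subset by blast

lemma finite_neighbours [simp]: "finite (neighbours E i)"
  using finite_subset[OF neighbours_subset] by simp

lemma neighbours_sym: "j \<in> neighbours E i \<longleftrightarrow> i \<in> neighbours E j"
  by (simp add: neighbours_def insert_commute)

lemma not_neighbour_self: "i \<notin> neighbours E i"
  using graph by (fastforce simp: simple_graph_def neighbours_def)

lemma card_neighbours_le: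
  assumes "i \<in> {1..n}"
  shows "card (neighbours E i) + 2 \<le> q"
proof -
  have "card (neighbours E i) \<le> max_degree n E"
    unfolding max_degree_def using assms by (intro Max_ge) auto
  with colors show ?thesis
    by simp
qed

text \<open>The two colors beyond the maximum degree enter here. They keep the probability of any
  particular pick of a player in conflict at most 1/2, the range in which
  \<open>one_minus_ge_exp_ln4\<close> applies.\<close>

lemma card_free_colors: "i \<in> {1..n} \<Longrightarrow> 2 \<le> card (free_colors l i)"
  using diff_card_le_card_Diff[of "l ` neighbours E i" "{1..q}"]
    card_image_le[of "neighbours E i" l] card_neighbours_le[of i]
  by (simp add: free_colors_def)

lemma free_colors_nonempty: "i \<in> {1..n} \<Longrightarrow> free_colors l i \<noteq> {}"
  using card_free_colors[of i l] by auto

lemma next_color_conflicted: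
  "payoff E l i \<noteq> 1 \<Longrightarrow> next_color E q l i = pmf_of_set (free_colors l i)"
  by (simp add: next_color_def free_colors_def)

lemma pmf_next_color_conflicted:
  "i \<in> {1..n} \<Longrightarrow> payoff E l i \<noteq> 1 \<Longrightarrow>
    pmf (next_color E q l i) c = indicator (free_colors l i) c / card (free_colors l i)"
  by (simp add: next_color_conflicted pmf_of_set free_colors_nonempty)

lemma pmf_next_color_conflicted_le:
  assumes "i \<in> {1..n}" "payoff E l i \<noteq> 1"
  shows "pmf (next_color E q l i) c \<le> 1/2"
  unfolding pmf_next_color_conflicted[OF assms]
  using card_free_colors[OF assms(1), of l] by (auto simp: indicator_def field_simps)

lemma set_next_color:
  assumes "i \<in> {1..n}"
  shows "set_pmf (next_color E q l i) = (if payoff E l i = 1 then {l i} else free_colors l i)"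
  using free_colors_nonempty[OF assms] by (simp add: next_color_conflicted) (simp add: next_color_def)

lemma set_next_coloring:
  "set_pmf (next_coloring n E q l) =
    (\<Pi>\<^sub>E i\<in>{1..n}. if payoff E l i = 1 then {l i} else free_colors l i)"
proof -
  \<comment> \<open>The default value \<open>undefined\<close> makes the support of the product pmf
    an extensional product.\<close>
  have "PiE_dflt {1..n} undefined B = PiE {1..n} B" for B :: "nat \<Rightarrow> nat set"
    unfolding PiE_dflt_def PiE_iff extensional_def by blast
  then show ?thesis
    by (simp add: next_coloring_def set_Pi_pmf) (rule PiE_cong, simp add: set_next_color)
qed

lemma next_coloring_happy:
  assumes "l' \<in> set_pmf (next_coloring n E q l)" "i \<in> {1..n}" "payoff E l i = 1"
  shows "l' i = l i"
  using PiE_mem[OF assms(1)[unfolded set_next_coloring] assms(2)] assms(3) by simp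

lemma next_coloring_conflicted:
  assumes "l' \<in> set_pmf (next_coloring n E q l)" "i \<in> {1..n}" "payoff E l i \<noteq> 1"
  shows "l' i \<in> free_colors l i"
  using PiE_mem[OF assms(1)[unfolded set_next_coloring] assms(2)] assms(3) by simp

text \<open>Player \<open>i\<close> and its neighbours with payoff 1 keep their distinct colors,
  while a neighbour in conflict must avoid \<open>l i\<close>, a color it has just seen at
  \<open>i\<close>.\<close>

lemma payoff_next_coloring:
  assumes l': "l' \<in> set_pmf (next_coloring n E q l)" and i: "i \<in> {1..n}" and "payoff E l i = 1"
  shows "payoff E l' i = 1"
proof -
  have "l' i \<noteq> l' j" if j: "j \<in> neighbours E i" for j
  proof -
    have "j \<in> {1..n}" and "i \<in> neighbours E j"
      using j neighbours_subset neighbours_sym by blast+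
    have "l i \<noteq> l j"
      using assms(3) j by (auto simp: payoff_def split: if_splits)
    then show ?thesis
      using next_coloring_happy[OF l' i] next_coloring_happy[OF l' \<open>j \<in> {1..n}\<close>]
        next_coloring_conflicted[OF l' \<open>j \<in> {1..n}\<close>] assms(3) \<open>i \<in> neighbours E j\<close>
      by (cases "payoff E l j = 1") (fastforce simp: free_colors_def)+
  qed
  then show ?thesis
    by (auto simp: payoff_def)
qed

lemma prob_next_coloring_Pi:
  "measure_pmf.prob (next_coloring n E q l) (Pi {1..n} B) =
    (\<Prod>i\<in>{1..n}. measure_pmf.prob (next_color E q l i) (B i))"
  unfolding next_coloring_def by (rule measure_Pi_pmf_Pi) simp

lemma prob_next_color_avoid:
  "measure_pmf.prob (next_color E q l i) (- {c}) = 1 - pmf (next_color E q l i) c"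
  using measure_pmf.prob_compl[of "{c}" "next_color E q l i"]
  by (simp add: measure_pmf_single Compl_eq_Diff_UNIV)

text \<open>The event is a box with unrestricted sides outside \<open>U\<close>, so independence
  factors its probability.\<close>

lemma prob_next_coloring_avoid:
  assumes "U \<subseteq> {1..n}"
  shows "measure_pmf.prob (next_coloring n E q l) {l'. \<forall>j\<in>U. l' j \<noteq> c} =
    (\<Prod>j\<in>U. 1 - pmf (next_color E q l j) c)"
proof -
  have "{l'. \<forall>j\<in>U. l' j \<noteq> c} = Pi {1..n} (\<lambda>j. if j \<in> U then - {c} else UNIV)"
    using assms by (fastforce simp: Pi_iff simp del: atLeastAtMost_iff split: if_splits)
  then have "measure_pmf.prob (next_coloring n E q l) {l'. \<forall>j\<in>U. l' j \<noteq> c} =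
      (\<Prod>j\<in>{1..n}. if j \<in> U then 1 - pmf (next_color E q l j) c else 1)"
    by (simp only: prob_next_coloring_Pi)
       (auto intro!: prod.cong simp: prob_next_color_avoid)
  also have "\<dots> = (\<Prod>j\<in>U. 1 - pmf (next_color E q l j) c)"
    using assms by (simp add: prod.If_cases Int_absorb1)
  finally show ?thesis .
qed

lemma prob_next_coloring_eq_avoid:
  assumes "U \<subseteq> {1..n}" "i \<in> {1..n}" "i \<notin> U"
  shows "measure_pmf.prob (next_coloring n E q l) {l'. l' i = c \<and> (\<forall>j\<in>U. l' j \<noteq> c)} =
    pmf (next_color E q l i) c * (\<Prod>j\<in>U. 1 - pmf (next_color E q l j) c)"
proof -
  let ?B = "\<lambda>j. if j = i then {c} else if j \<in> U then - {c} else UNIV"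
  have "{l'. l' i = c \<and> (\<forall>j\<in>U. l' j \<noteq> c)} = Pi {1..n} ?B"
  proof (intro equalityI subsetI)
    fix l' assume "l' \<in> Pi {1..n} ?B"
    then have *: "l' j \<in> ?B j" if "j \<in> {1..n}" for j
      using that by blast
    show "l' \<in> {l'. l' i = c \<and> (\<forall>j\<in>U. l' j \<noteq> c)}"
      using *[of i] * assms by (fastforce split: if_splits)
  qed (use assms in auto)
  then have "measure_pmf.prob (next_coloring n E q l) {l'. l' i = c \<and> (\<forall>j\<in>U. l' j \<noteq> c)} =
      (\<Prod>j\<in>{1..n}. measure_pmf.prob (next_color E q l j) (?B j))"
    by (simp only: prob_next_coloring_Pi)
  also have "\<dots> = pmf (next_color E q l i) c *
      (\<Prod>j\<in>{1..n} - {i}. measure_pmf.prob (next_color E q l j) (?B j))"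
    using assms by (subst prod.remove[of _ i]) (auto simp: measure_pmf_single)
  also have "(\<Prod>j\<in>{1..n} - {i}. measure_pmf.prob (next_color E q l j) (?B j)) =
      (\<Prod>j\<in>{1..n} - {i}. if j \<in> U then 1 - pmf (next_color E q l j) c else 1)"
    by (intro prod.cong) (auto simp: prob_next_color_avoid)
  also have "\<dots> = (\<Prod>j\<in>U. 1 - pmf (next_color E q l j) c)"
    using assms by (simp add: prod.If_cases Int_absorb1 subset_Diff_insert)
  finally show ?thesis .
qed

text \<open>This serves both rounds: the available colors with \<open>K = 1\<close> in the first,
  the free colors with \<open>K = 8\<close> in the second.\<close>

lemma sum_prod_next_color_ge:
  assumes "U \<subseteq> {1..n}" "\<And>j. j \<in> U \<Longrightarrow> payoff E l j \<noteq> 1" "finite S" "card U \<le> K * card S"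
  shows "real (card S) / 4 ^ K \<le> (\<Sum>c\<in>S. \<Prod>j\<in>U. 1 - pmf (next_color E q l j) c)"
proof (rule sum_prod_one_minus_ge)
  show "finite U"
    using assms(1) by (rule finite_subset) simp
  show "(\<Sum>c\<in>S. pmf (next_color E q l j) c) \<le> 1" for j
    using \<open>finite S\<close> by (simp add: measure_measure_pmf_finite[symmetric])
qed (use assms pmf_next_color_conflicted_le in auto)

section \<open>Resolving the conflict of one player within two rounds\<close>

definition conflicted_neighbours :: "coloring \<Rightarrow> nat \<Rightarrow> nat set" where
  "conflicted_neighbours l i = {j \<in> neighbours E i. payoff E l j \<noteq> 1}"

text \<open>The colors that are not held by a neighbour of \<open>i\<close> with payoff \<open>1\<close>; the others are taken for good.\<close>

definition available_colors :: "coloring \<Rightarrow> nat \<Rightarrow> nat set" where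
  "available_colors l i = {1..q} - l ` (neighbours E i - conflicted_neighbours l i)"

lemma conflicted_neighbours_subset: "conflicted_neighbours l i \<subseteq> neighbours E i"
  by (auto simp: conflicted_neighbours_def)

lemma finite_conflicted_neighbours [simp]: "finite (conflicted_neighbours l i)"
  by (simp add: conflicted_neighbours_def)

text \<open>Each neighbour with payoff 1 blocks at most one color. Of at least deg + 2 colors, at
  least d + 2 therefore remain, where d counts the neighbours in conflict.\<close>

lemma card_conflicted_neighbours_less:
  assumes "i \<in> {1..n}"
  shows "card (conflicted_neighbours l i) < card (available_colors l i)"
proof -
  let ?N = "neighbours E i" and ?U = "conflicted_neighbours l i"
  have "card (?N - ?U) = card ?N - card ?U" "card ?U \<le> card ?N"
    using conflicted_neighbours_subset[of l i]
    by (auto intro!: card_Diff_subset card_mono)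
  then show ?thesis
    using diff_card_le_card_Diff[of "l ` (?N - ?U)" "{1..q}"]
      card_image_le[of "?N - ?U" l] card_neighbours_le[OF assms]
    by (simp add: available_colors_def)
qed

text \<open>Neighbours with payoff 1 do not move, so only those in conflict decide which available
  colors become free. The number of free colors is thus a sum of indicators.\<close>

lemma free_colors_next_coloring:
  assumes "l' \<in> set_pmf (next_coloring n E q l)"
  shows "free_colors l' i = {c \<in> available_colors l i. \<forall>j\<in>conflicted_neighbours l i. l' j \<noteq> c}"
proof -
  have "l' j = l j" if "j \<in> neighbours E i - conflicted_neighbours l i" for j
    using that next_coloring_happy[OF assms neighbour_vertex, of j i]
    by (auto simp: conflicted_neighbours_def)
  then have *: "l' ` (neighbours E i - conflicted_neighbours l i) =
      l ` (neighbours E i - conflicted_neighbours l i)"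
    by (rule image_cong[OF refl])
  have "l' ` neighbours E i = l ` (neighbours E i - conflicted_neighbours l i) \<union>
      l' ` conflicted_neighbours l i"
    using conflicted_neighbours_subset[of l i]
    by (subst *[symmetric]) (auto simp: image_Un[symmetric])
  then show ?thesis
    by (auto simp: free_colors_def available_colors_def)
qed

text \<open>Linearity of expectation over the available colors; they outnumber the neighbours in
  conflict, so the estimate applies with \<open>K = 1\<close>.\<close>

lemma expectation_card_free_colors_ge:
  assumes "i \<in> {1..n}"
  shows "real (card (available_colors l i)) / 4 \<le>
    measure_pmf.expectation (next_coloring n E q l) (\<lambda>l'. real (card (free_colors l' i)))"
proof -
  let ?U = "conflicted_neighbours l i" and ?S = "available_colors l i"
  have U: "?U \<subseteq> {1..n}"
    using conflicted_neighbours_subset neighbours_subset by blast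
  have fin: "finite ?S"
    by (simp add: available_colors_def)
  have "real (card ?S) / 4 = real (card ?S) / 4 ^ 1"
    by simp
  also have "\<dots> \<le> (\<Sum>c\<in>?S. \<Prod>j\<in>?U. 1 - pmf (next_color E q l j) c)"
    using card_conflicted_neighbours_less[OF assms, of l] U fin
    by (intro sum_prod_next_color_ge) (auto simp: conflicted_neighbours_def)
  also have "\<dots> = (\<Sum>c\<in>?S. measure_pmf.expectation (next_coloring n E q l)
      (indicator {l'. \<forall>j\<in>?U. l' j \<noteq> c}))"
    by (simp add: prob_next_coloring_avoid[OF U])
  also have "\<dots> = measure_pmf.expectation (next_coloring n E q l)
      (\<lambda>l'. \<Sum>c\<in>?S. indicator {l'. \<forall>j\<in>?U. l' j \<noteq> c} l')"
    by (subst Bochner_Integration.integral_sum)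
       (auto intro!: measure_pmf.integrable_const_bound[where B = 1])
  also have "\<dots> = measure_pmf.expectation (next_coloring n E q l)
      (\<lambda>l'. real (card (free_colors l' i)))"
  proof (intro integral_cong_AE AE_pmfI)
    fix l' assume "l' \<in> set_pmf (next_coloring n E q l)"
    then show "(\<Sum>c\<in>?S. indicator {l'. \<forall>j\<in>?U. l' j \<noteq> c} l') = real (card (free_colors l' i))"
      using fin by (simp add: free_colors_next_coloring indicator_def sum.If_cases of_bool_def Int_def)
  qed auto
  finally show ?thesis .
qed

text \<open>The pick of \<open>i\<close> is uniform on its free colors and independent of the other
  picks. Hence the probability that all neighbours in conflict miss it is the average over these
  colors, to which the estimate applies.\<close>

lemma prob_resolve_ge:
  assumes i: "i \<in> {1..n}" and "payoff E l i \<noteq> 1"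
    and "card (conflicted_neighbours l i) \<le> K * card (free_colors l i)"
  shows "1 / 4 ^ K \<le> measure_pmf.prob (next_coloring n E q l) (- conflicted i)"
proof -
  let ?U = "conflicted_neighbours l i" and ?F = "free_colors l i"
  let ?A = "\<lambda>c. {l'. l' i = c \<and> (\<forall>j\<in>?U. l' j \<noteq> c)}"
  have U: "?U \<subseteq> {1..n}" "i \<notin> ?U"
    using conflicted_neighbours_subset neighbours_subset not_neighbour_self by blast+
  have F: "0 < real (card ?F)"
    using card_free_colors[OF i, of l] by linarith
  have "1 / 4 ^ K = 1 / real (card ?F) * (real (card ?F) / 4 ^ K)"
    using F free_colors_nonempty[OF i] by simp
  also have "\<dots> \<le> 1 / real (card ?F) * (\<Sum>c\<in>?F. \<Prod>j\<in>?U. 1 - pmf (next_color E q l j) c)"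
    using U assms by (intro mult_left_mono sum_prod_next_color_ge) (auto simp: conflicted_neighbours_def)
  also have "\<dots> = (\<Sum>c\<in>?F. measure_pmf.prob (next_coloring n E q l) (?A c))"
    by (simp add: prob_next_coloring_eq_avoid[OF U(1) i U(2)]
        pmf_next_color_conflicted[OF i assms(2)] sum_distrib_left)
  also have "\<dots> = measure_pmf.prob (next_coloring n E q l) (\<Union>c\<in>?F. ?A c)"
    by (rule measure_pmf.finite_measure_finite_Union[symmetric])
       (auto simp: disjoint_family_on_def)
  also have "\<dots> \<le> measure_pmf.prob (next_coloring n E q l) (- conflicted i)"
  proof (rule measure_pmf.finite_measure_mono_AE)
    \<comment> \<open>The inclusion holds only on the support, where neighbours with payoff 1 keep
      their colors and a free color avoids them.\<close>
    show "AE l' in next_coloring n E q l. l' \<in> (\<Union>c\<in>?F. ?A c) \<longrightarrow> l' \<in> - conflicted i"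
    proof (intro AE_pmfI impI)
      fix l' assume l': "l' \<in> set_pmf (next_coloring n E q l)" and "l' \<in> (\<Union>c\<in>?F. ?A c)"
      then have F: "l' i \<in> ?F" and avoid: "\<forall>j\<in>?U. l' j \<noteq> l' i"
        by auto
      have "l' i \<noteq> l' j" if j: "j \<in> neighbours E i" for j
      proof (cases "j \<in> ?U")
        case False
        then have "l' j = l j"
          using next_coloring_happy[OF l' neighbour_vertex[OF j]] j
          by (auto simp: conflicted_neighbours_def)
        then show ?thesis
          using F j by (auto simp: free_colors_def)
      qed (use avoid in auto)
      then show "l' \<in> - conflicted i"
        by (auto simp: payoff_def)
    qed
  qed simp
  finally show ?thesis .
qed

text \<open>A reverse Markov argument on the fraction of available colors that the first round
  leaves free. The indicator on the right, due to the permanence of payoff 1, makes the bound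
  iterable.\<close>

lemma prob_conflicted_two_rounds_le:
  assumes i: "i \<in> {1..n}"
  shows "measure_pmf.prob (next_coloring n E q l \<bind> next_coloring n E q) (conflicted i)
    \<le> (1 - \<delta>) * indicator (conflicted i) l"
proof (cases "payoff E l i = 1")
  case True
  have "measure_pmf.prob (next_coloring n E q l \<bind> next_coloring n E q) (conflicted i) = 0"
    using payoff_next_coloring i True by (auto simp: measure_pmf_zero_iff)
  then show ?thesis
    using True by simp
next
  case False
  let ?m = "real (card (available_colors l i))"
  let ?happy = "\<lambda>l'. measure_pmf.prob (next_coloring n E q l') (- conflicted i)"
  have m: "0 < ?m"
    using card_conflicted_neighbours_less[OF i, of l] by simp
  have fin: "finite (available_colors l i)"
    by (simp add: available_colors_def)
  \<comment> \<open>A linear minorant: it is at most 0 for fractions up to 1/8, and never exceeds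
    \<open>8 * \<delta>\<close>, which is 4^-8, since the fraction is at most 1.\<close>
  have pointwise: "8 * \<delta> * (real (card (free_colors l' i)) / ?m - 1/8) \<le> ?happy l'"
    if l': "l' \<in> set_pmf (next_coloring n E q l)" for l'
  proof (cases "real (card (free_colors l' i)) / ?m \<le> 1/8")
    case True
    then have "8 * \<delta> * (real (card (free_colors l' i)) / ?m - 1/8) \<le> 0"
      by (intro mult_nonneg_nonpos) (auto simp: \<delta>_def)
    also have "\<dots> \<le> ?happy l'"
      by simp
    finally show ?thesis .
  next
    case False
    have "card (free_colors l' i) \<le> card (available_colors l i)"
      using fin by (auto simp: free_colors_next_coloring[OF l'] intro: card_mono)
    then have "real (card (free_colors l' i)) / ?m - 1/8 \<le> 1"
      using m by (simp add: field_simps)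
    then have "8 * \<delta> * (real (card (free_colors l' i)) / ?m - 1/8) \<le> 8 * \<delta> * 1"
      by (intro mult_left_mono) (auto simp: \<delta>_def)
    also have "\<dots> = 1 / 4 ^ 8"
      by (simp add: \<delta>_def)
    also have "\<dots> \<le> ?happy l'"
    proof (cases "payoff E l' i = 1")
      case True
      then have "?happy l' = 1"
        using payoff_next_coloring[OF _ i True]
        by (auto simp: measure_pmf.prob_eq_1 AE_measure_pmf_iff)
      then show ?thesis
        by simp
    next
      case conflict: False
      \<comment> \<open>No new conflicts arise, so the bound on neighbours in conflict from before
        the first round still holds after it.\<close>
      have "conflicted_neighbours l' i \<subseteq> conflicted_neighbours l i"
        using payoff_next_coloring[OF l' neighbour_vertex]
        by (auto simp: conflicted_neighbours_def)
      then have "card (conflicted_neighbours l' i) \<le> card (conflicted_neighbours l i)"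
        by (intro card_mono) simp_all
      also have "\<dots> \<le> card (available_colors l i)"
        using card_conflicted_neighbours_less[OF i] by (rule less_imp_le)
      also have "\<dots> \<le> 8 * card (free_colors l' i)"
        using False m by (simp add: field_simps)
      finally show ?thesis
        by (rule prob_resolve_ge[OF i conflict])
    qed
    finally show ?thesis .
  qed
  have fin_set: "finite (set_pmf (next_coloring n E q l))"
    unfolding set_next_coloring by (intro finite_PiE) auto
  have "\<delta> = 8 * \<delta> * ((?m / 4) / ?m - 1/8)"
    using m by simp
  also have "\<dots> \<le> 8 * \<delta> * (measure_pmf.expectation (next_coloring n E q l)
      (\<lambda>l'. real (card (free_colors l' i))) / ?m - 1/8)"
    using expectation_card_free_colors_ge[OF i, of l] m
    by (intro mult_left_mono diff_right_mono divide_right_mono) (auto simp: \<delta>_def)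
  also have "\<dots> = measure_pmf.expectation (next_coloring n E q l)
      (\<lambda>l'. 8 * \<delta> * (real (card (free_colors l' i)) / ?m - 1/8))"
    using fin_set by (simp add: integrable_measure_pmf_finite)
  also have "\<dots> \<le> measure_pmf.expectation (next_coloring n E q l) ?happy"
    using fin_set pointwise
    by (intro integral_mono_AE) (auto simp: integrable_measure_pmf_finite AE_measure_pmf_iff)
  also have "\<dots> = measure_pmf.prob (next_coloring n E q l \<bind> next_coloring n E q) (- conflicted i)"
    by (simp add: measure_bind_pmf_eq_integral)
  also have "\<dots> = 1 - measure_pmf.prob (next_coloring n E q l \<bind> next_coloring n E q) (conflicted i)"
    using measure_pmf.prob_compl[of "conflicted i"] by (simp add: Compl_eq_Diff_UNIV)
  finally show ?thesis
    using False by simp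
qed

section \<open>Geometric decay and the logarithmic bound\<close>

lemma prob_conflicted_le:
  assumes i: "i \<in> {1..n}"
  shows "measure_pmf.prob (coloring_after n E q l0 t) (conflicted i) \<le> 2 * sqrt (1 - \<delta>) ^ t"
\<comment> \<open>Two rounds gain the factor \<open>1 - \<delta>\<close>, the square of the rate.
  The constant 2 covers \<open>t = 1\<close>, where only the trivial bound 1 is used.\<close>
proof (induction t rule: induct_nat_012)
  case 1
  have "1 \<le> 2 * sqrt (1 - \<delta>)"
    using real_le_rsqrt[of "1/2" "1 - \<delta>"] by (simp add: \<delta>_def power2_eq_square)
  then show ?case
    using order_trans[OF measure_pmf.prob_le_1] by simp
next
  case (ge2 t)
  let ?step = "next_coloring n E q"
  have "coloring_after n E q l0 (Suc (Suc t)) = coloring_after n E q l0 t \<bind> (\<lambda>l. ?step l \<bind> ?step)"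
    by (simp add: bind_assoc_pmf)
  then have "measure_pmf.prob (coloring_after n E q l0 (Suc (Suc t))) (conflicted i) =
      measure_pmf.expectation (coloring_after n E q l0 t)
        (\<lambda>l. measure_pmf.prob (?step l \<bind> ?step) (conflicted i))"
    by (simp add: measure_bind_pmf_eq_integral)
  also have "\<dots> \<le> measure_pmf.expectation (coloring_after n E q l0 t)
      (\<lambda>l. (1 - \<delta>) * indicator (conflicted i) l)"
    using prob_conflicted_two_rounds_le[OF i]
    by (intro integral_mono measure_pmf.integrable_const_bound[where B = 1])
       (auto simp: \<delta>_def indicator_def)
  also have "\<dots> = (1 - \<delta>) * measure_pmf.prob (coloring_after n E q l0 t) (conflicted i)"
    by simp
  also have "\<dots> \<le> (1 - \<delta>) * (2 * sqrt (1 - \<delta>) ^ t)"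
    using ge2(1) by (intro mult_left_mono) (auto simp: \<delta>_def)
  also have "\<dots> = 2 * sqrt (1 - \<delta>) ^ Suc (Suc t)"
    by (simp add: \<delta>_def)
  finally show ?case .
qed (simp add: indicator_def)

lemma prob_unresolved_le:
  "measure_pmf.prob (coloring_after n E q l0 t) {l. \<exists>i\<in>{1..n}. payoff E l i \<noteq> 1}
     \<le> 2 * real n * sqrt (1 - \<delta>) ^ t"
proof -
  have "{l. \<exists>i\<in>{1..n}. payoff E l i \<noteq> 1} = (\<Union>i\<in>{1..n}. conflicted i)"
    by auto
  then have "measure_pmf.prob (coloring_after n E q l0 t) {l. \<exists>i\<in>{1..n}. payoff E l i \<noteq> 1}
      \<le> (\<Sum>i\<in>{1..n}. measure_pmf.prob (coloring_after n E q l0 t) (conflicted i))"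
    by (simp only:) (rule measure_pmf.finite_measure_subadditive_finite, auto)
  also have "\<dots> \<le> (\<Sum>i\<in>{1..n}. 2 * sqrt (1 - \<delta>) ^ t)"
    by (intro sum_mono prob_conflicted_le)
  finally show ?thesis
    by simp
qed

end

text \<open>The sum is split at the first \<open>k\<close> with \<open>a * r ^ k \<le> 1\<close>.
  Earlier terms are bounded by 1, later ones by a geometric series starting at 1; the summand 1 pays
  for rounding \<open>k\<close> up.\<close>

lemma suminf_truncated_geometric_le:
  fixes r a :: real and f :: "nat \<Rightarrow> real"
  assumes r: "0 < r" "r < 1" and a: "1 \<le> a"
    and f: "\<And>t. 0 \<le> f t" "\<And>t. f t \<le> 1" "\<And>t. f t \<le> a * r ^ t"
  shows "(\<Sum>t. ennreal (f t)) \<le> ennreal (ln a / ln (1 / r) + 1 + 1 / (1 - r))"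
proof -
  define k where "k = nat \<lceil>ln a / ln (1 / r)\<rceil>"
  have ln_r: "0 < ln (1 / r)" "ln (1 / r) = - ln r"
    using r by (auto simp: ln_div)
  have k: "ln a / ln (1 / r) \<le> real k" "real k \<le> ln a / ln (1 / r) + 1"
    using a ln_r(1) by (auto simp: k_def of_nat_nat intro: divide_nonneg_pos)
  have "ln a \<le> real k * - ln r"
    using k(1) ln_r by (simp add: field_simps)
  then have "ln (a * r ^ k) \<le> 0"
    using r a by (simp add: ln_mult ln_realpow)
  then have ark: "a * r ^ k \<le> 1"
    using r a by (subst (asm) ln_le_zero_iff) auto
  have "summable (\<lambda>t. a * r ^ t)"
    using r by (intro summable_mult summable_geometric) auto
  then have summ: "summable f"
    by (rule summable_comparison_test'[where N = 0]) (simp add: f)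
  have "(\<Sum>t. f t) = (\<Sum>t. f (t + k)) + (\<Sum>t<k. f t)"
    by (rule suminf_split_initial_segment[OF summ])
  moreover have "(\<Sum>t. f (t + k)) \<le> (\<Sum>t. r ^ t)"
  proof (rule suminf_le)
    fix t
    have "f (t + k) \<le> (a * r ^ k) * r ^ t"
      using f(3)[of "t + k"] by (simp add: power_add mult_ac)
    also have "\<dots> \<le> 1 * r ^ t"
      using ark r by (intro mult_right_mono) auto
    finally show "f (t + k) \<le> r ^ t"
      by simp
  qed (use summ r in \<open>auto intro: summable_geometric summable_ignore_initial_segment\<close>)
  moreover have "(\<Sum>t. r ^ t) = 1 / (1 - r)"
    using r by (intro suminf_geometric) auto
  moreover have "(\<Sum>t<k. f t) \<le> real k"
    using sum_bounded_above[of "{..<k}" f 1] f(2) by simp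
  ultimately have "(\<Sum>t. f t) \<le> ln a / ln (1 / r) + 1 + 1 / (1 - r)"
    using k(2) by simp
  then show ?thesis
    using suminf_ennreal2[OF f(1) summ] by (simp add: ennreal_leI)
qed

theorem theorem1:
  shows "\<exists>C::real. C > 0 \<and>
    (\<forall>(n::nat) (E::nat set set) (q::nat) (l0::coloring).
       n \<ge> 2 \<longrightarrow> simple_graph n E \<longrightarrow> q \<ge> max_degree n E + 2 \<longrightarrow>
       l0 \<in> {1..n} \<rightarrow>\<^sub>E {1..q} \<longrightarrow>
       (\<integral>\<^sup>+ \<omega>. ennreal_of_enat (conflict_resolving_time n E \<omega>) \<partial>game_law n E q l0)
         \<le> ennreal (C * ln (real n)))"
proof -
  define r where "r = sqrt (1 - \<delta>)"
  have r: "0 < r" "r < 1"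
    by (auto simp: r_def \<delta>_def)
  \<comment> \<open>For n at least 2, ln (2 n) is at most 2 ln n, and the additive constant
    \<open>D\<close> is at most D ln n / ln 2; these give the two summands of
    \<open>C\<close>.\<close>
  define D where "D = 1 + 1 / (1 - r)"
  define C where "C = 2 / ln (1 / r) + D / ln 2"
  have pos: "0 < ln (1 / r)" "0 < D"
    using r by (auto simp: D_def ln_div add_pos_pos)
  show ?thesis
  proof (intro exI[of _ C] conjI allI impI)
    show "C > 0"
      using pos by (auto simp: C_def intro!: add_pos_pos)
  next
    fix n :: nat and E :: "nat set set" and q :: nat and l0 :: coloring
    assume n: "n \<ge> 2" and game: "simple_graph n E" "q \<ge> max_degree n E + 2"
    interpret coloring_game n E q
      using game by unfold_locales
    have "(\<integral>\<^sup>+ \<omega>. ennreal_of_enat (conflict_resolving_time n E \<omega>) \<partial>game_law n E q l0)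
        \<le> (\<Sum>t. ennreal (measure_pmf.prob (coloring_after n E q l0 t)
              {l. \<exists>i\<in>{1..n}. payoff E l i \<noteq> 1}))"
      using expected_conflict_resolving_time_le by (simp add: measure_pmf.emeasure_eq_measure)
    also have "\<dots> \<le> ennreal (ln (2 * real n) / ln (1 / r) + 1 + 1 / (1 - r))"
      using prob_unresolved_le[of l0] r n
      by (intro suminf_truncated_geometric_le) (auto simp: r_def)
    also have "\<dots> \<le> ennreal (C * ln (real n))"
    proof (rule ennreal_leI)
      have ln2: "ln 2 \<le> ln (real n)" "0 < ln (2::real)"
        using n by auto
      have "ln (2 * real n) / ln (1 / r) \<le> 2 * ln (real n) / ln (1 / r)"
        using n ln2 pos by (intro divide_right_mono) (auto simp: ln_mult)
      moreover have "D \<le> D * (ln (real n) / ln 2)"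
        using ln2 pos by (simp add: field_simps)
      ultimately show "ln (2 * real n) / ln (1 / r) + 1 + 1 / (1 - r) \<le> C * ln (real n)"
        by (simp add: C_def D_def algebra_simps)
    qed
    finally show "(\<integral>\<^sup>+ \<omega>. ennreal_of_enat (conflict_resolving_time n E \<omega>) \<partial>game_law n E q l0)
        \<le> ennreal (C * ln (real n))" .
  qed
qed

end
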